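(* The number $\phi(k,n;\Gamma)$ of $k\times n$ $(0,1)$-matrices avoiding $\Gamma=\begin{pmatrix}1&1\\1&0\end{pmatrix}$ is given by $$\phi(k,n;\Gamma)=\sum_{m=0}^{\min(k,n)} m!\,S(n+1,m+1)\,S(k+1,m+1).$$
   Context: A $(0,1)$-matrix is a matrix with all entries in $\{0,1\}$. A $2\times2$ submatrix of a matrix is obtained by choosing two rows $i_1<i_2$ and two columns $j_1<j_2$. For a $2\times 2$ $(0,1)$-matrix $P$, let $[P]$ be its equivalence class under row exchanges and column exchanges. A $(0,1)$-matrix avoids $P$ if none of its $2\times2$ submatrices belongs to $[P]$. Here $[\Gamma]$ consists of the four $2\times2$ $(0,1)$-matrices with exactly three entries equal to $1$. $\phi(k,n;\Gamma)$ is the number of $k\times n$ $(0,1)$-matrices avoiding $\Gamma$. By convention, the set of $0\times 0$ matrices is $\{\emptyset\}$ and the sets of $k\times 0$ and of $0\times n$ matrices are empty for positive integers $k$ and $n$, so that $\phi(0,0;\Gamma)=1$ and $\phi(k,0;\Gamma)=\phi(0,n;\Gamma)=0$ for positive integers $k$ and $n$. $S(n,m)$ denotes the Stirling number of the second kind, i.e. the number of set partitions of an $n$-element set into $m$ nonempty blocks.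
   Formalization: The formula is proved when k and n are both positive or both zero; if exactly one of them is zero, the stated convention gives φ = 0 while the right-hand side equals 1, so these cases are excluded. *)

theory Defs
  imports
    "Jordan_Normal_Form.DL_Submatrix"
    "Jordan_Normal_Form.Column_Operations"
    "HOL-Combinatorics.Stirling"
begin

text \<open>Rows and columns are indexed from 0, so the two rows and columns of a
  \<open>2 \<times> 2\<close> matrix have indices 0 and 1.\<close>

inductive_set exchange_class :: "nat mat \<Rightarrow> nat mat set" for P :: "nat mat" where
  self: "P \<in> exchange_class P"
| row_exchange: "Q \<in> exchange_class P \<Longrightarrow> swaprows 0 1 Q \<in> exchange_class P"
| column_exchange: "Q \<in> exchange_class P \<Longrightarrow> swapcols 0 1 Q \<in> exchange_class P"

definition avoids :: "nat mat \<Rightarrow> nat mat \<Rightarrow> bool" where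
  "avoids A P \<longleftrightarrow>
    (\<forall>i1 i2 j1 j2. i1 < i2 \<and> i2 < dim_row A \<and> j1 < j2 \<and> j2 < dim_col A
       \<longrightarrow> submatrix A {i1, i2} {j1, j2} \<notin> exchange_class P)"

text \<open>\<open>carrier_mat k 0\<close> and \<open>carrier_mat 0 n\<close> contain one matrix each. The convention
  adopted here is that there is one \<open>0 \<times> 0\<close> matrix, but no \<open>k \<times> 0\<close> or \<open>0 \<times> n\<close> matrix
  for positive \<open>k\<close> and \<open>n\<close>.\<close>

definition zero_one_matrices :: "nat \<Rightarrow> nat \<Rightarrow> nat mat set" where
  "zero_one_matrices k n =
    (if k = 0 \<longleftrightarrow> n = 0 then {A \<in> carrier_mat k n. elements_mat A \<subseteq> {0, 1}} else {})"

definition phi :: "nat \<Rightarrow> nat \<Rightarrow> nat mat \<Rightarrow> nat" where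
  "phi k n P = card {A \<in> zero_one_matrices k n. avoids A P}"

definition Gamma_mat :: "nat mat" where
  "Gamma_mat = mat_of_rows_list 2 [[1, 1], [1, 0]]"

end

theory Submission
  imports Defs "HOL-Library.Disjoint_Sets" "HOL-Library.FuncSet"
begin

text \<open>
  A matrix contains a member of \<open>[\<Gamma>]\<close> exactly when two of its rows have supports (sets of
  columns carrying a 1) that meet but differ: a common column, a column in only one of the two
  supports, and the two rows give three 1s and a 0. So the matrices avoiding \<open>\<Gamma>\<close> are
  those whose row supports are pairwise equal or disjoint (\<open>avoids_Gamma_mat_iff\<close>).

  Such a matrix is determined in two independent stages. The distinct nonempty supports form a
  set \<open>P\<close> of disjoint blocks of columns, not necessarily covering all columns. There are
  \<open>S(n+1, m+1)\<close> choices of \<open>P\<close> with \<open>m\<close> blocks, because the uncovered columns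
  together with one extra point can serve as an additional block
  (\<open>card_partial_partitions_of_card\<close>). Once \<open>P\<close> is fixed, each row picks a block of
  \<open>P\<close> or the empty support, and every block must be picked. The rows picking a given block
  and the rows of zeros again describe a partial partition, now of the rows and with its blocks
  labelled by \<open>P\<close>, which gives \<open>m! S(k+1, m+1)\<close> choices
  (\<open>card_covering_maps\<close>). Summing over \<open>P\<close> yields the formula
  (\<open>card_block_maps\<close>).

  Both counts are obtained by checking the recurrence
  \<open>S(n+1, m+1) = (m+1) S(n, m+1) + S(n, m)\<close> while one element is added to the ground set.
\<close>

section \<open>Maps covering all but a distinguished value\<close>

text \<open>The value \<open>z\<close>, assumed to lie outside \<open>X\<close>, may be attained or not; it
  will stand for the empty row support.\<close>

definition covering_maps :: "'a set \<Rightarrow> 'b set \<Rightarrow> 'b \<Rightarrow> ('a \<Rightarrow> 'b) set" where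
  "covering_maps A X z = {f \<in> A \<rightarrow>\<^sub>E insert z X. X \<subseteq> f ` A}"

lemma finite_covering_maps:
  assumes "finite A" "finite X"
  shows "finite (covering_maps A X z)"
  unfolding covering_maps_def using assms by (simp add: finite_PiE)

text \<open>A map that need not attain \<open>y\<close> either attains it anyway, or avoids it and then
  takes its values in \<open>X - {y}\<close> and \<open>z\<close> only.\<close>

lemma maps_covering_all_but_one:
  assumes "y \<in> X" "z \<notin> X"
  shows "{g \<in> A \<rightarrow>\<^sub>E insert z X. X - {y} \<subseteq> g ` A} =
    covering_maps A X z \<union> covering_maps A (X - {y}) z"
proof (intro equalityI subsetI)
  fix g assume g: "g \<in> {g \<in> A \<rightarrow>\<^sub>E insert z X. X - {y} \<subseteq> g ` A}"
  show "g \<in> covering_maps A X z \<union> covering_maps A (X - {y}) z"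
  proof (cases "y \<in> g ` A")
    case True
    then show ?thesis using g by (auto simp: covering_maps_def)
  next
    case False
    then have "g \<in> A \<rightarrow>\<^sub>E insert z (X - {y})"
      using g by (fastforce simp: PiE_iff)
    then show ?thesis using g by (auto simp: covering_maps_def)
  qed
next
  fix g assume "g \<in> covering_maps A X z \<union> covering_maps A (X - {y}) z"
  then show "g \<in> {g \<in> A \<rightarrow>\<^sub>E insert z X. X - {y} \<subseteq> g ` A}"
    by (auto simp: covering_maps_def PiE_iff)
qed

lemma card_maps_covering_all_but_one:
  assumes "finite A" "finite X" "y \<in> X" "z \<notin> X"
  shows "card {g \<in> A \<rightarrow>\<^sub>E insert z X. X - {y} \<subseteq> g ` A} =
    card (covering_maps A X z) + card (covering_maps A (X - {y}) z)"
proof -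
  have "covering_maps A X z \<inter> covering_maps A (X - {y}) z = {}"
    using assms(3,4) by (fastforce simp: covering_maps_def PiE_iff)
  then show ?thesis
    unfolding maps_covering_all_but_one[OF assms(3,4)]
    using assms(1,2) by (intro card_Un_disjoint finite_covering_maps) auto
qed

text \<open>Once the new argument has received the value \<open>y\<close>, the old arguments only have to
  cover \<open>X - {y}\<close>.\<close>

lemma covering_maps_insert:
  assumes "a \<notin> A"
  shows "covering_maps (insert a A) X z =
    (\<lambda>(y, g). g(a := y)) ` (SIGMA y:insert z X. {g \<in> A \<rightarrow>\<^sub>E insert z X. X - {y} \<subseteq> g ` A})"
proof -
  have "(g(a := y)) ` A = g ` A" for g :: "'a \<Rightarrow> 'b" and y
    using assms by (intro image_cong) auto
  then show ?thesis
    unfolding covering_maps_def PiE_insert_eq by (auto 0 3)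
qed

text \<open>By \<open>covering_maps_insert\<close>, the count \<open>c(a, x)\<close> with \<open>a\<close> arguments
  and \<open>x\<close> values to cover satisfies \<open>c(a+1, x) = (x+1) c(a, x) + x c(a, x-1)\<close>: the new
  argument takes any of the \<open>x+1\<close> values while the old ones already cover \<open>X\<close>, or it
  supplies the only value of \<open>X\<close> that they miss. Dividing by \<open>x!\<close> turns this into
  the recurrence of the Stirling numbers with both arguments shifted by one.\<close>

lemma card_covering_maps:
  assumes "finite A" "finite X" "z \<notin> X"
  shows "card (covering_maps A X z) = fact (card X) * Stirling (card A + 1) (card X + 1)"
  using assms
proof (induction A arbitrary: X rule: finite_induct)
  case empty
  show ?case
  proof (cases "X = {}")
    case True
    then show ?thesis by (simp add: covering_maps_def)
  next
    case False
    with empty have "card X > 0" by (simp add: card_gt_0_iff)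
    then have "Stirling 1 (card X + 1) = 0" by (intro Stirling_less) simp
    with False show ?thesis by (simp add: covering_maps_def)
  qed
next
  case (insert a A)
  let ?S = "\<lambda>y. {g \<in> A \<rightarrow>\<^sub>E insert z X. X - {y} \<subseteq> g ` A}"
  let ?c = "Stirling (card A + 1)"
  have fin: "finite (?S y)" for y
    using insert.hyps insert.prems by (simp add: finite_PiE)
  have inj: "inj_on (\<lambda>(y, g). g(a := y)) (SIGMA y:insert z X. ?S y)"
    using inj_combinator[OF insert.hyps(2), of "\<lambda>_. insert z X"]
    by (rule inj_on_subset) auto
  have "card (covering_maps (insert a A) X z) = (\<Sum>y\<in>insert z X. card (?S y))"
    unfolding covering_maps_insert[OF insert.hyps(2)] card_image[OF inj]
    using insert.prems fin by (intro card_SigmaI) auto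
  also have "\<dots> = card (?S z) + (\<Sum>y\<in>X. card (?S y))"
    using insert.prems by simp
  also have "?S z = covering_maps A X z"
    using insert.prems by (simp add: covering_maps_def)
  also have "(\<Sum>y\<in>X. card (?S y)) =
      (\<Sum>y\<in>X. card (covering_maps A X z) + card (covering_maps A (X - {y}) z))"
    using insert by (intro sum.cong refl card_maps_covering_all_but_one) auto
  also have "\<dots> = (\<Sum>y\<in>X. fact (card X) * ?c (card X + 1) + fact (card X - 1) * ?c (card X))"
  proof (intro sum.cong refl arg_cong2[where f = "(+)"])
    fix y assume y: "y \<in> X"
    then have "card X > 0" using insert.prems by (auto simp: card_gt_0_iff)
    then show "card (covering_maps A (X - {y}) z) = fact (card X - 1) * ?c (card X)"
      using insert.IH[of "X - {y}"] insert.prems y by simp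
  qed (use insert in simp)
  also have "card (covering_maps A X z) = fact (card X) * ?c (card X + 1)"
    using insert by simp
  finally have "card (covering_maps (insert a A) X z) =
      (card X + 1) * (fact (card X) * ?c (card X + 1)) + card X * fact (card X - 1) * ?c (card X)"
    by (simp add: algebra_simps)
  also have "\<dots> = fact (card X) * Stirling (card A + 2) (card X + 1)"
    by (cases "card X") (simp_all add: algebra_simps)
  finally show ?case
    using insert.hyps by simp
qed

section \<open>Partial partitions\<close>

definition partial_partitions :: "'a set \<Rightarrow> 'a set set set" where
  "partial_partitions A = {P. P \<subseteq> Pow A \<and> {} \<notin> P \<and> disjoint P}"

definition partial_partitions_of_card :: "'a set \<Rightarrow> nat \<Rightarrow> 'a set set set" where
  "partial_partitions_of_card A m = {P \<in> partial_partitions A. card P = m}"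

lemma finite_partial_partitions: "finite A \<Longrightarrow> finite (partial_partitions A)"
  by (rule finite_subset[of _ "Pow (Pow A)"]) (auto simp: partial_partitions_def)

lemma finite_partial_partitions_of_card: "finite A \<Longrightarrow> finite (partial_partitions_of_card A m)"
  unfolding partial_partitions_of_card_def by (simp add: finite_partial_partitions)

lemma finite_partial_partition: "finite A \<Longrightarrow> P \<in> partial_partitions A \<Longrightarrow> finite P"
  using finite_subset[of P "Pow A"] by (simp add: partial_partitions_def)

lemma partial_partitions_notin:
  assumes "P \<in> partial_partitions A" "a \<notin> A" "B \<in> P"
  shows "a \<notin> B"
  using assms by (auto simp: partial_partitions_def)

definition enlarge_block :: "'a \<Rightarrow> 'a set set \<times> 'a set \<Rightarrow> 'a set set" where
  "enlarge_block a = (\<lambda>(P, B). insert (insert a B) (P - {B}))"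

text \<open>The new element \<open>a\<close> is in no block, forms a block of its own, or has joined a
  block that was there before.\<close>

lemma partial_partitions_insert:
  assumes "a \<notin> A"
  shows "partial_partitions (insert a A) =
    partial_partitions A \<union> insert {a} ` partial_partitions A \<union>
    enlarge_block a ` (SIGMA P:partial_partitions A. P)"
    (is "?L = ?R1 \<union> ?R2 \<union> ?R3")
proof (intro equalityI subsetI)
  fix P assume P: "P \<in> ?L"
  show "P \<in> ?R1 \<union> ?R2 \<union> ?R3"
  proof (cases "a \<in> \<Union>P")
    case False
    then have "P \<in> ?R1" using P by (auto simp: partial_partitions_def)
    then show ?thesis by blast
  next
    case True
    then obtain C where C: "C \<in> P" "a \<in> C" by blast
    have disj: "D \<inter> C = {}" if "D \<in> P - {C}" for D
      using that C P by (auto simp: partial_partitions_def disjoint_def)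
    have notin: "a \<notin> D" if "D \<in> P - {C}" for D
      using disj[OF that] C by auto
    have sub: "P - {C} \<in> partial_partitions A"
      using P notin by (auto simp: partial_partitions_def disjoint_def)
    show ?thesis
    proof (cases "C = {a}")
      case True
      then have "P = insert {a} (P - {C})" using C by auto
      then show ?thesis using sub by blast
    next
      case False
      define B where "B = C - {a}"
      have B: "C = insert a B" "a \<notin> B" "B \<noteq> {}" "B \<subseteq> A"
        using False C P by (auto simp: B_def partial_partitions_def)
      have BP: "B \<notin> P"
        using disj[of B] B by auto
      have "disjoint (insert B (P - {C}))"
        using sub disj B by (auto simp: partial_partitions_def disjoint_def)
      then have "insert B (P - {C}) \<in> partial_partitions A"
        using sub B by (auto simp: partial_partitions_def)
      moreover have "P = enlarge_block a (insert B (P - {C}), B)"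
        using B BP C by (auto simp: enlarge_block_def)
      ultimately have "P \<in> ?R3" by blast
      then show ?thesis by blast
    qed
  qed
next
  fix P assume "P \<in> ?R1 \<union> ?R2 \<union> ?R3"
  then consider "P \<in> ?R1" | "P \<in> ?R2" | "P \<in> ?R3" by blast
  then show "P \<in> ?L"
  proof cases
    case 1
    then show ?thesis by (auto simp: partial_partitions_def)
  next
    case 2
    then show ?thesis using assms by (auto simp: partial_partitions_def disjoint_def)
  next
    case 3
    then obtain Q B where Q: "Q \<in> partial_partitions A" "B \<in> Q" "P = insert (insert a B) (Q - {B})"
      by (auto simp: enlarge_block_def)
    have "D \<inter> insert a B = {}" if "D \<in> Q - {B}" for D
      using that Q assms partial_partitions_notin[OF Q(1) assms, of D]
      by (auto simp: partial_partitions_def disjoint_def)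
    then have "disjoint P"
      using Q by (simp add: partial_partitions_def disjoint_def Int_commute)
    then show ?thesis using Q by (auto simp: partial_partitions_def)
  qed
qed

text \<open>The enlarged block is recognizable as the only one containing \<open>a\<close>.\<close>

lemma inj_on_enlarge_block:
  assumes "a \<notin> A"
  shows "inj_on (enlarge_block a) (SIGMA P:partial_partitions A. P)"
proof (rule inj_onI, clarify)
  fix P B Q C
  assume P: "P \<in> partial_partitions A" "B \<in> P" and Q: "Q \<in> partial_partitions A" "C \<in> Q"
    and eq: "enlarge_block a (P, B) = enlarge_block a (Q, C)"
  note nP = partial_partitions_notin[OF P(1) assms] 
  note nQ = partial_partitions_notin[OF Q(1) assms]
  have "insert a B \<in> insert (insert a C) (Q - {C})"
    using eq by (auto simp: enlarge_block_def)
  then have BC: "insert a B = insert a C" using nQ by blast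
  then have "B = C" using nP[OF P(2)] nQ[OF Q(2)] by (simp add: insert_ident)
  moreover have "P - {B} = Q - {C}"
  proof -
    have "enlarge_block a (P, B) - {insert a B} = P - {B}"
      using nP by (auto simp: enlarge_block_def)
    moreover have "enlarge_block a (Q, C) - {insert a C} = Q - {C}"
      using nQ by (auto simp: enlarge_block_def)
    ultimately show ?thesis using eq BC by simp
  qed
  ultimately show "P = Q \<and> B = C" using P(2) Q(2) by blast
qed

lemma card_enlarge_block:
  assumes "finite A" "a \<notin> A" "P \<in> partial_partitions A" "B \<in> P"
  shows "card (enlarge_block a (P, B)) = card P"
proof -
  have "insert a B \<notin> P"
    using partial_partitions_notin[OF assms(3,2)] by blast
  moreover have "finite P" using finite_partial_partition assms by blast
  moreover have "card P > 0" using assms(4) \<open>finite P\<close> by (auto simp: card_gt_0_iff)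
  ultimately show ?thesis
    using assms(4) by (simp add: enlarge_block_def card_Diff_singleton)
qed

lemma partial_partitions_of_card_0: "finite A \<Longrightarrow> partial_partitions_of_card A 0 = {{}}"
proof -
  assume "finite A"
  then have "{P \<in> partial_partitions A. card P = 0} = {P \<in> partial_partitions A. P = {}}"
    using finite_partial_partition[of A] by (intro Collect_cong conj_cong refl) simp
  also have "\<dots> = {{}}"
  proof (rule Set.set_eqI)
    show "P \<in> {P \<in> partial_partitions A. P = {}} \<longleftrightarrow> P \<in> {{}}" for P
      by (cases "P = {}") (simp_all add: partial_partitions_def)
  qed
  finally show ?thesis unfolding partial_partitions_of_card_def .
qed

lemma partial_partitions_of_card_insert_Suc:
  assumes "finite A" "a \<notin> A"
  shows "partial_partitions_of_card (insert a A) (Suc m) =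
    partial_partitions_of_card A (Suc m) \<union> insert {a} ` partial_partitions_of_card A m \<union>
    enlarge_block a ` (SIGMA P:partial_partitions_of_card A (Suc m). P)"
proof -
  have new: "card (insert {a} P) = Suc (card P)" if "P \<in> partial_partitions A" for P
  proof -
    have "{a} \<notin> P" using partial_partitions_notin[OF that assms(2)] by blast
    then show ?thesis using finite_partial_partition[OF assms(1) that] by simp
  qed
  have img: "{Q \<in> f ` S. card Q = Suc m} = f ` {x \<in> S. card (f x) = Suc m}"
    for f :: "'b \<Rightarrow> 'a set set" and S
    by blast
  have "{P \<in> partial_partitions A. card (insert {a} P) = Suc m} = partial_partitions_of_card A m"
    using new by (auto simp: partial_partitions_of_card_def)
  moreover have "{x \<in> (SIGMA P:partial_partitions A. P). card (enlarge_block a x) = Suc m} =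
      (SIGMA P:partial_partitions_of_card A (Suc m). P)"
    using card_enlarge_block[OF assms] by (auto simp: partial_partitions_of_card_def)
  moreover have "partial_partitions_of_card (insert a A) (Suc m) =
      {P \<in> partial_partitions A. card P = Suc m} \<union>
      {P \<in> insert {a} ` partial_partitions A. card P = Suc m} \<union>
      {P \<in> enlarge_block a ` (SIGMA P:partial_partitions A. P). card P = Suc m}"
    unfolding partial_partitions_of_card_def partial_partitions_insert[OF assms(2)] by blast
  ultimately show ?thesis
    unfolding img by (simp only: partial_partitions_of_card_def)
qed

text \<open>The three cases for a new element contribute \<open>N(n, m)\<close>, \<open>N(n, m-1)\<close>
  and \<open>m N(n, m)\<close>, the last one because any of the \<open>m\<close> blocks can be enlarged. This is
  the recurrence of \<open>S(n+1, m+1)\<close>.\<close>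

lemma card_partial_partitions_of_card:
  assumes "finite A"
  shows "card (partial_partitions_of_card A m) = Stirling (card A + 1) (m + 1)"
  using assms
proof (induction A arbitrary: m rule: finite_induct)
  case empty
  have "partial_partitions {} = {{} :: 'a set set}"
    by (auto simp: partial_partitions_def)
  then have "partial_partitions_of_card ({} :: 'a set) (Suc l) = {}" for l
    by (simp add: partial_partitions_of_card_def Collect_conv_if)
  then show ?case
    using partial_partitions_of_card_0[of "{} :: 'a set"] by (cases m) simp_all
next
  case (insert a A)
  show ?case
  proof (cases m)
    case 0
    then show ?thesis
      using insert.hyps by (simp add: partial_partitions_of_card_0 del: Stirling.simps)
  next
    case (Suc l)
    let ?N = "partial_partitions_of_card A"
    let ?S1 = "?N (Suc l)" and ?S2 = "insert {a} ` ?N l"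
    let ?S3 = "enlarge_block a ` (SIGMA P:?N (Suc l). P)"
    have sub: "?N j \<subseteq> partial_partitions A" for j
      by (auto simp: partial_partitions_of_card_def)
    note notin = partial_partitions_notin[OF subsetD[OF sub] insert.hyps(2)]
    have fin: "finite (?N j)" for j
      using finite_partial_partitions_of_card insert.hyps(1) by blast
    have finP: "finite P" if "P \<in> ?N j" for P j
      using that finite_partial_partition insert.hyps(1) sub by blast
    have "?S1 \<inter> ?S2 = {}" using notin by blast
    moreover have "?S1 \<inter> ?S3 = {}"
    proof -
      have "insert a B \<in> enlarge_block a (P, B)" for P B
        by (simp add: enlarge_block_def)
      then show ?thesis using notin by blast
    qed
    moreover have "?S2 \<inter> ?S3 = {}"
    proof -
      have "{a} \<notin> enlarge_block a (P, B)" if "P \<in> ?N (Suc l)" "B \<in> P" for P B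
      proof -
        have "B \<noteq> {}"
          using subsetD[OF sub that(1)] that(2) by (auto simp: partial_partitions_def)
        then have "insert a B \<noteq> {a}"
          using notin[OF that] by auto
        then show ?thesis
          using notin[OF that(1), of "{a}"] by (auto simp: enlarge_block_def)
      qed
      then show ?thesis by blast
    qed
    moreover have "card ?S2 = card (?N l)"
    proof (intro card_image inj_onI)
      fix P Q assume PQ: "P \<in> ?N l" "Q \<in> ?N l" and eq: "insert {a} P = insert {a} Q"
      have "{a} \<notin> P" "{a} \<notin> Q" using notin[OF PQ(1)] notin[OF PQ(2)] by auto
      then show "P = Q" using eq by (simp add: insert_ident)
    qed
    moreover have "card ?S3 = (\<Sum>P\<in>?N (Suc l). card P)"
    proof -
      have "inj_on (enlarge_block a) (SIGMA P:?N (Suc l). P)"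
        using inj_on_enlarge_block[OF insert.hyps(2)] by (rule inj_on_subset) (use sub in blast)
      then have "card ?S3 = card (SIGMA P:?N (Suc l). P)" by (rule card_image)
      also have "\<dots> = (\<Sum>P\<in>?N (Suc l). card P)"
        using fin finP by (intro card_SigmaI) auto
      finally show ?thesis .
    qed
    moreover have "(\<Sum>P\<in>?N (Suc l). card P) = Suc l * card (?N (Suc l))"
      by (simp add: partial_partitions_of_card_def)
    moreover have "finite ?S3" using fin finP by (intro finite_imageI finite_SigmaI) auto
    ultimately have "card (partial_partitions_of_card (insert a A) (Suc l)) =
        card (?N (Suc l)) + card (?N l) + Suc l * card (?N (Suc l))"
      unfolding partial_partitions_of_card_insert_Suc[OF insert.hyps(1,2)]
      using fin by (simp add: card_Un_disjoint Int_Un_distrib2)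
    then show ?thesis
      using insert Suc by simp
  qed
qed

section \<open>Families of pairwise equal or disjoint sets\<close>

text \<open>With \<open>A\<close> as the set of rows and \<open>C\<close> as the set of columns, these are the
  possible assignments of supports to the rows of a matrix avoiding \<open>\<Gamma>\<close>.\<close>

definition block_maps :: "'a set \<Rightarrow> 'b set \<Rightarrow> ('a \<Rightarrow> 'b set) set" where
  "block_maps A C = {f \<in> A \<rightarrow>\<^sub>E Pow C. \<forall>i\<in>A. \<forall>i'\<in>A. f i = f i' \<or> f i \<inter> f i' = {}}"

text \<open>Two values in \<open>insert {} P\<close> are automatically equal or disjoint, so fixing the set
  of nonempty values leaves the covering of \<open>P\<close> as the only constraint.\<close>

lemma block_maps_fibre:
  assumes "P \<in> partial_partitions C"
  shows "{f \<in> block_maps A C. f ` A - {{}} = P} = covering_maps A P {}"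
proof (intro equalityI subsetI)
  fix f assume "f \<in> {f \<in> block_maps A C. f ` A - {{}} = P}"
  then show "f \<in> covering_maps A P {}"
    by (auto simp: block_maps_def covering_maps_def PiE_iff)
next
  fix f assume f: "f \<in> covering_maps A P {}"
  have P: "P \<subseteq> Pow C" "{} \<notin> P" "disjoint P"
    using assms by (auto simp: partial_partitions_def)
  have val: "f i \<in> insert {} P" if "i \<in> A" for i
    using f that by (auto simp: covering_maps_def)
  have "f \<in> A \<rightarrow>\<^sub>E Pow C"
    using f P(1) by (auto simp: covering_maps_def PiE_iff)
  moreover have "f i = f i' \<or> f i \<inter> f i' = {}" if "i \<in> A" "i' \<in> A" for i i'
    using val[OF that(1)] val[OF that(2)] P(3) by (auto simp: disjoint_def)
  moreover have "f ` A - {{}} = P"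
    using f P(2) val by (auto simp: covering_maps_def)
  ultimately show "f \<in> {f \<in> block_maps A C. f ` A - {{}} = P}"
    by (simp add: block_maps_def)
qed

lemma card_block_maps:
  assumes "finite A" "finite C"
  shows "card (block_maps A C) =
    (\<Sum>m = 0..min (card A) (card C).
      fact m * Stirling (card C + 1) (m + 1) * Stirling (card A + 1) (m + 1))"
proof -
  let ?t = "\<lambda>m. fact m * Stirling (card A + 1) (m + 1)"
  have fin: "finite (block_maps A C)"
    unfolding block_maps_def using assms by (simp add: finite_PiE)
  have finPP: "finite (partial_partitions C)"
    using assms by (simp add: finite_partial_partitions)
  have le: "card P \<le> card C" if P: "P \<in> partial_partitions C" for P
  proof (rule ccontr)
    assume "\<not> card P \<le> card C"
    then have "card (partial_partitions_of_card C (card P)) = 0"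
      by (simp add: card_partial_partitions_of_card[OF assms(2)] del: Stirling.simps)
    then show False
      using P finite_partial_partitions_of_card[OF assms(2)]
      by (auto simp: partial_partitions_of_card_def)
  qed
  have img: "(\<lambda>f. f ` A - {{}}) ` block_maps A C \<subseteq> partial_partitions C"
    by (fastforce simp: block_maps_def partial_partitions_def disjoint_def PiE_iff)
  have "card (block_maps A C) =
      (\<Sum>P\<in>partial_partitions C. card {f \<in> block_maps A C. f ` A - {{}} = P})"
    using sum.group[OF fin finPP img, of "\<lambda>_. 1::nat"] by simp
  also have "\<dots> = (\<Sum>P\<in>partial_partitions C. ?t (card P))"
  proof (rule sum.cong[OF refl])
    fix P assume P: "P \<in> partial_partitions C"
    have "{} \<notin> P" using P by (simp add: partial_partitions_def)
    then show "card {f \<in> block_maps A C. f ` A - {{}} = P} = ?t (card P)"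
      unfolding block_maps_fibre[OF P]
      by (rule card_covering_maps[OF assms(1) finite_partial_partition[OF assms(2) P]])
  qed
  also have "\<dots> = (\<Sum>m\<in>{0..card C}. \<Sum>P\<in>partial_partitions_of_card C m. ?t (card P))"
    unfolding partial_partitions_of_card_def
    using le by (intro sum.group[symmetric] finPP) auto
  also have "\<dots> = (\<Sum>m\<in>{0..card C}. Stirling (card C + 1) (m + 1) * ?t m)"
  proof (rule sum.cong[OF refl])
    fix m
    have "(\<Sum>P\<in>partial_partitions_of_card C m. ?t (card P)) =
        (\<Sum>P\<in>partial_partitions_of_card C m. ?t m)"
      by (rule sum.cong[OF refl]) (simp add: partial_partitions_of_card_def)
    then show "(\<Sum>P\<in>partial_partitions_of_card C m. ?t (card P)) =
        Stirling (card C + 1) (m + 1) * ?t m"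
      using card_partial_partitions_of_card[OF assms(2)] by simp
  qed
  \<comment> \<open>For \<open>m > card A\<close> the rows are too few to pick every block, and the factor
    \<open>Stirling (card A + 1) (m + 1)\<close> vanishes.\<close>
  also have "\<dots> = (\<Sum>m = 0..min (card A) (card C). Stirling (card C + 1) (m + 1) * ?t m)"
    by (rule sum.mono_neutral_right) (auto simp del: Stirling.simps)
  finally show ?thesis
    by (simp add: mult_ac del: Stirling.simps)
qed

section \<open>Avoidance in terms of row supports\<close>

definition single_zero_mat :: "nat \<Rightarrow> nat \<Rightarrow> nat mat" where
  "single_zero_mat p q = mat 2 2 (\<lambda>(i, j). if i = p \<and> j = q then 0 else 1)"

lemma mat_2_2_eq_iff: "mat 2 2 f = mat 2 2 g \<longleftrightarrow> (\<forall>i<2. \<forall>j<2. f (i, j) = g (i, j))"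
  by (auto simp: mat_eq_iff)

lemma all_less_2_iff: "(\<forall>i<2. R i) \<longleftrightarrow> R 0 \<and> R (1::nat)"
  by (auto simp: less_2_cases_iff)

lemma ex_less_2_iff: "(\<exists>i<2. R i) \<longleftrightarrow> R 0 \<or> R (1::nat)"
  by (auto simp: less_2_cases_iff)

lemma Gamma_mat_eq: "Gamma_mat = single_zero_mat 1 1"
proof -
  have "Gamma_mat = mat 2 2 (\<lambda>(i, j). [[1, 1], [1, 0]] ! i ! j)"
    by (simp add: Gamma_mat_def mat_of_rows_list_def numeral_2_eq_2)
  also have "\<dots> = single_zero_mat 1 1"
    unfolding single_zero_mat_def mat_2_2_eq_iff all_less_2_iff by simp
  finally show ?thesis .
qed

lemma swaprows_single_zero_mat:
  assumes "p < 2"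
  shows "swaprows 0 1 (single_zero_mat p q) = single_zero_mat (1 - p) q"
proof -
  have "p = 0 \<or> p = 1" using assms by auto
  then show ?thesis
    unfolding mat_swaprows_def single_zero_mat_def dim_row_mat dim_col_mat mat_2_2_eq_iff all_less_2_iff
    by auto
qed

lemma swapcols_single_zero_mat:
  assumes "q < 2"
  shows "swapcols 0 1 (single_zero_mat p q) = single_zero_mat p (1 - q)"
proof -
  have "q = 0 \<or> q = 1" using assms by auto
  then show ?thesis
    unfolding mat_swapcols_def single_zero_mat_def dim_row_mat dim_col_mat mat_2_2_eq_iff all_less_2_iff
    by auto
qed

text \<open>The exchanges carry the zero to any of the four positions and never change the number
  of zeros.\<close>

lemma exchange_class_Gamma_mat:
  "exchange_class Gamma_mat = {single_zero_mat p q | p q. p < 2 \<and> q < 2}"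
proof (intro equalityI subsetI)
  fix Q assume "Q \<in> exchange_class Gamma_mat"
  then show "Q \<in> {single_zero_mat p q | p q. p < 2 \<and> q < 2}"
  proof induction
    case self
    have "(1::nat) < 2" by simp
    then show ?case unfolding Gamma_mat_eq by blast
  next
    case (row_exchange Q)
    then obtain p q where "p < 2" "q < 2" "Q = single_zero_mat p q" by blast
    moreover have "1 - p < 2" by simp
    ultimately show ?case using swaprows_single_zero_mat by blast
  next
    case (column_exchange Q)
    then obtain p q where "p < 2" "q < 2" "Q = single_zero_mat p q" by blast
    moreover have "1 - q < 2" by simp
    ultimately show ?case using swapcols_single_zero_mat by blast
  qed
next
  let ?E = "exchange_class Gamma_mat"
  have 11: "single_zero_mat 1 1 \<in> ?E"
    using exchange_class.self[of Gamma_mat] by (simp add: Gamma_mat_eq)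
  have 01: "single_zero_mat 0 1 \<in> ?E"
    using exchange_class.row_exchange[OF 11] by (simp add: swaprows_single_zero_mat del: One_nat_def)
  have 10: "single_zero_mat 1 0 \<in> ?E"
    using exchange_class.column_exchange[OF 11] by (simp add: swapcols_single_zero_mat del: One_nat_def)
  have 00: "single_zero_mat 0 0 \<in> ?E"
    using exchange_class.column_exchange[OF 01] by (simp add: swapcols_single_zero_mat del: One_nat_def)
  fix Q assume "Q \<in> {single_zero_mat p q | p q. p < 2 \<and> q < 2}"
  then show "Q \<in> ?E"
    using 00 01 10 11 by (auto simp: less_2_cases_iff)
qed

lemma pick_pair:
  assumes "i1 < i2"
  shows "pick {i1, i2} 0 = i1" "pick {i1, i2} 1 = i2"
proof -
  show 0: "pick {i1, i2} 0 = i1"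
    using assms by (auto intro!: Least_equality)
  have "pick {i1, i2} 1 = (LEAST a. a \<in> {i1, i2} \<and> a > i1)"
    using 0 by simp
  also have "\<dots> = i2"
    using assms by (intro Least_equality) auto
  finally show "pick {i1, i2} 1 = i2" .
qed

lemma submatrix_pair:
  assumes "i1 < i2" "i2 < dim_row A" "j1 < j2" "j2 < dim_col A"
  shows "submatrix A {i1, i2} {j1, j2} =
    mat 2 2 (\<lambda>(i, j). A $$ (if i = 0 then i1 else i2, if j = 0 then j1 else j2))"
proof -
  have "{i. i < dim_row A \<and> i \<in> {i1, i2}} = {i1, i2}" "{j. j < dim_col A \<and> j \<in> {j1, j2}} = {j1, j2}"
    using assms by auto
  moreover have "card {i1, i2} = 2" "card {j1, j2} = 2"
    using assms by auto
  ultimately show ?thesis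
    unfolding submatrix_def
    by (simp only: mat_2_2_eq_iff all_less_2_iff prod.case pick_pair[OF assms(1)] pick_pair[OF assms(3)]) simp
qed

text \<open>The right-hand side depends only on the unordered pairs of rows and columns, so it can
  be used without knowing which of two given indices is the smaller one.\<close>

lemma submatrix_pair_in_exchange_class_Gamma_mat:
  assumes "i1 < i2" "i2 < dim_row A" "j1 < j2" "j2 < dim_col A"
  shows "submatrix A {i1, i2} {j1, j2} \<in> exchange_class Gamma_mat \<longleftrightarrow>
    (\<exists>a\<in>{i1, i2}. \<exists>b\<in>{j1, j2}. \<forall>i\<in>{i1, i2}. \<forall>j\<in>{j1, j2}.
      A $$ (i, j) = (if i = a \<and> j = b then 0 else 1))"
proof -
  have "submatrix A {i1, i2} {j1, j2} \<in> exchange_class Gamma_mat \<longleftrightarrow>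
      (\<exists>p<2. \<exists>q<2. submatrix A {i1, i2} {j1, j2} = single_zero_mat p q)"
    unfolding exchange_class_Gamma_mat by blast
  also have "\<dots> \<longleftrightarrow> (\<exists>p<2. \<exists>q<2. \<forall>i<2. \<forall>j<2.
      A $$ (if i = (0::nat) then i1 else i2, if j = (0::nat) then j1 else j2) =
        (if i = p \<and> j = q then 0 else 1))"
    unfolding submatrix_pair[OF assms] single_zero_mat_def mat_2_2_eq_iff prod.case ..
  also have "\<dots> \<longleftrightarrow> (\<exists>a\<in>{i1, i2}. \<exists>b\<in>{j1, j2}. \<forall>i\<in>{i1, i2}. \<forall>j\<in>{j1, j2}.
      A $$ (i, j) = (if i = a \<and> j = b then 0 else 1))"
    using assms(1,3) unfolding all_less_2_iff ex_less_2_iff by simp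
  finally show ?thesis .
qed

definition row_support :: "nat mat \<Rightarrow> nat \<Rightarrow> nat set" where
  "row_support A i = {j. j < dim_col A \<and> A $$ (i, j) = 1}"

text \<open>If the supports of rows \<open>i\<close> and \<open>i'\<close> share column \<open>j\<close>, and only the
  former contains \<open>j'\<close>, then these rows and columns form a submatrix whose only zero is at
  \<open>(i', j')\<close>. Conversely, in a submatrix with a single zero, the column
  without the zero shows that the supports meet, and the other column that they differ.\<close>

lemma avoids_Gamma_mat_iff:
  assumes "elements_mat A \<subseteq> {0, 1}"
  shows "avoids A Gamma_mat \<longleftrightarrow>
    (\<forall>i<dim_row A. \<forall>i'<dim_row A.
      row_support A i = row_support A i' \<or> row_support A i \<inter> row_support A i' = {})"
    (is "_ \<longleftrightarrow> ?D")
proof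
  assume av: "avoids A Gamma_mat"
  have False
    if i: "i < dim_row A" "i' < dim_row A"
      and j: "j \<in> row_support A i" "j \<in> row_support A i'"
      and j': "j' \<in> row_support A i" "j' \<notin> row_support A i'" for i i' j j'
  proof -
    have ne: "i \<noteq> i'" "j \<noteq> j'" using j j' by auto
    have jl: "j < dim_col A" "j' < dim_col A"
      and v: "A $$ (i, j) = 1" "A $$ (i', j) = 1" "A $$ (i, j') = 1" "A $$ (i', j') \<noteq> 1"
      using j j' by (auto simp: row_support_def)
    have "A $$ (i', j') = 0"
      using v(4) assms elements_matI[of A "dim_row A" "dim_col A" i' j' "A $$ (i', j')"] i jl by auto
    with v ne have
      "\<exists>a\<in>{i, i'}. \<exists>b\<in>{j, j'}. \<forall>x\<in>{i, i'}. \<forall>y\<in>{j, j'}.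
        A $$ (x, y) = (if x = a \<and> y = b then 0 else 1)"
      by (intro bexI[of _ i'] bexI[of _ j']) auto
    moreover have "{min i i', max i i'} = {i, i'}" "{min j j', max j j'} = {j, j'}"
      by (auto simp: min_def max_def)
    ultimately have "submatrix A {min i i', max i i'} {min j j', max j j'} \<in> exchange_class Gamma_mat"
      using submatrix_pair_in_exchange_class_Gamma_mat[of "min i i'" "max i i'" A "min j j'" "max j j'"]
        ne i jl by simp
    moreover have "min i i' < max i i'" "max i i' < dim_row A" "min j j' < max j j'" "max j j' < dim_col A"
      using ne i jl by auto
    ultimately show False using av unfolding avoids_def by blast
  qed
  then show ?D by blast
next
  assume D: ?D
  show "avoids A Gamma_mat"
    unfolding avoids_def
  proof (intro allI impI, elim conjE)
    fix i1 i2 j1 j2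
    assume ij: "i1 < i2" "i2 < dim_row A" "j1 < j2" "j2 < dim_col A"
    have D': "row_support A i1 = row_support A i2 \<or> row_support A i1 \<inter> row_support A i2 = {}"
      using D ij by auto
    have "A $$ (i1, j) = 1 \<longleftrightarrow> A $$ (i2, j) = 1"
      if "A $$ (i1, j') = 1" "A $$ (i2, j') = 1" "j \<in> {j1, j2}" "j' \<in> {j1, j2}" for j j'
    proof -
      have jl: "j < dim_col A" "j' < dim_col A" using that ij by auto
      then have "j' \<in> row_support A i1 \<inter> row_support A i2"
        using that by (simp add: row_support_def)
      with D' have "row_support A i1 = row_support A i2" by blast
      then show ?thesis using jl by (auto simp: row_support_def)
    qed
    from this[of j1 j2] this[of j2 j1]
    show "submatrix A {i1, i2} {j1, j2} \<notin> exchange_class Gamma_mat"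
      unfolding submatrix_pair_in_exchange_class_Gamma_mat[OF ij] using ij(1,3) by auto
  qed
qed

text \<open>The assumption excludes the degenerate shapes for which \<open>zero_one_matrices k n\<close> is
  empty by convention although one map of supports exists.\<close>

lemma bij_betw_row_supports:
  assumes "k = 0 \<longleftrightarrow> n = 0"
  shows "bij_betw (\<lambda>A. restrict (row_support A) {..<k})
    {A \<in> zero_one_matrices k n. avoids A Gamma_mat} (block_maps {..<k} {..<n})"
proof (rule bij_betw_byWitness[where f' = "\<lambda>f. mat k n (\<lambda>(i, j). if j \<in> f i then 1 else 0)"])
  let ?M = "{A \<in> zero_one_matrices k n. avoids A Gamma_mat}"
  let ?F = "\<lambda>A. restrict (row_support A) {..<k}"
  let ?G = "\<lambda>f. mat k n (\<lambda>(i, j). if j \<in> f i then 1 else 0 :: nat)"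
  have M: "A \<in> ?M \<longleftrightarrow> A \<in> carrier_mat k n \<and> elements_mat A \<subseteq> {0, 1} \<and> avoids A Gamma_mat" for A
    using assms by (auto simp: zero_one_matrices_def)
  show "\<forall>A\<in>?M. ?G (?F A) = A"
  proof
    fix A assume A: "A \<in> ?M"
    show "?G (?F A) = A"
    proof (rule eq_matI)
      fix i j assume "i < dim_row A" "j < dim_col A"
      moreover from this have "A $$ (i, j) \<in> {0, 1}"
        using A elements_matI[of A k n i j "A $$ (i, j)"] unfolding M by auto
      ultimately show "?G (?F A) $$ (i, j) = A $$ (i, j)"
        using A unfolding M by (auto simp: row_support_def)
    qed (use A M in auto)
  qed
  have FG: "?F (?G f) = f" if "f \<in> block_maps {..<k} {..<n}" for f
  proof
    fix i
    show "?F (?G f) i = f i"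
    proof (cases "i < k")
      case True
      then have "f i \<subseteq> {..<n}" using that by (auto simp: block_maps_def PiE_iff)
      with True show ?thesis by (auto simp: row_support_def split: if_splits)
    next
      case False
      then show ?thesis using that by (simp add: block_maps_def PiE_iff extensional_def)
    qed
  qed
  then show "\<forall>f\<in>block_maps {..<k} {..<n}. ?F (?G f) = f" by blast
  show "?F ` ?M \<subseteq> block_maps {..<k} {..<n}"
  proof (rule image_subsetI)
    fix A assume A: "A \<in> ?M"
    then have "row_support A i = row_support A i' \<or> row_support A i \<inter> row_support A i' = {}"
      if "i < k" "i' < k" for i i'
      using avoids_Gamma_mat_iff[of A] that unfolding M by auto
    moreover have "row_support A i \<subseteq> {..<n}" for i
      using A unfolding M by (auto simp: row_support_def)
    ultimately show "?F A \<in> block_maps {..<k} {..<n}"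
      by (simp add: block_maps_def)
  qed
  show "?G ` block_maps {..<k} {..<n} \<subseteq> ?M"
  proof (rule image_subsetI)
    fix f assume f: "f \<in> block_maps {..<k} {..<n}"
    have el: "elements_mat (?G f) \<subseteq> {0, 1}"
      by (auto simp: elements_mat_def)
    have "row_support (?G f) i = f i" if "i < k" for i
      using fun_cong[OF FG[OF f], of i] that by simp
    then have "avoids (?G f) Gamma_mat"
      unfolding avoids_Gamma_mat_iff[OF el] using f by (auto simp: block_maps_def)
    then show "?G f \<in> ?M"
      unfolding M using el by simp
  qed
qed

theorem theorem3p1:
  fixes k n :: nat
  assumes "k = 0 \<longleftrightarrow> n = 0"
  shows "phi k n Gamma_mat =
    (\<Sum>m = 0..min k n. fact m * Stirling (n + 1) (m + 1) * Stirling (k + 1) (m + 1))"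
  unfolding phi_def bij_betw_same_card[OF bij_betw_row_supports[OF assms]]
  using card_block_maps[of "{..<k}" "{..<n}"] by simp

end
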